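(* Let $P$ be a finite poset. If $\#P=2m$ and $P$ is not tilable by dominos, then $P$ is sign-balanced. Similarly, if $\#P=2m+1\ge 3$ and there is some $j$ with $1\le j\le m+1$ such that $P$ is not $j$-tilable by dominos, then $P$ is sign-balanced.
   Context: A labeling of an $n$-element poset $P$ is a bijection $\omega:P\to[n]=\{1,\dots,n\}$ (not necessarily order-preserving). A linear extension of $P$ is an order-preserving bijection $f:P\to[n]$. Given $\omega$, each linear extension $f$ defines the permutation $\pi(f)=a_1a_2\cdots a_n$ of $[n]$ with $a_i=\omega(f^{-1}(i))$. The poset $P$ is sign-balanced if the number of linear extensions $f$ with $\pi(f)$ an even permutation equals the number with $\pi(f)$ an odd permutation; this does not depend on the choice of $\omega$. An order ideal of $P$ is a subset $K\subseteq P$ such that $t\in K$ and $s<t$ imply $s\in K$. A poset $P$ with $2m$ elements is tilable by dominos if there is a chain $\emptyset=K_0\subset K_1\subset\cdots\subset K_m=P$ of order ideals such that each subposet $K_i-K_{i-1}$ is a two-element chain. If $\#P=2m+1$ and $1\le j\le m+1$, then $P$ is $j$-tilable by dominos if there is a chain $\emptyset=K_0\subset K_1\subset\cdots\subset K_{m+1}=P$ of order ideals such that $K_i-K_{i-1}$ is a two-element chain for all $1\le i\le m+1$ with $i\ne j$ (so $\#(K_j-K_{j-1})=1$). *)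

theory Defs
  imports "HOL-Combinatorics.Permutations" "HOL-Library.FuncSet"
begin

text \<open>
  A finite poset is a finite carrier \<open>A\<close> with a relation \<open>r\<close> such that
  \<open>partial_order_on A r\<close>; \<open>(s, t) \<in> r\<close> means \<open>s \<le> t\<close>.
\<close>

definition labeling :: "'a set \<Rightarrow> ('a \<Rightarrow> nat) \<Rightarrow> bool" where
  "labeling A \<omega> \<longleftrightarrow> bij_betw \<omega> A {1..card A}"

text \<open>
  Linear extensions are counted below, so they are taken to be \<open>undefined\<close> outside \<open>A\<close>:
  each one is then represented by exactly one HOL function.
\<close>

definition linear_extensions :: "'a set \<Rightarrow> ('a \<times> 'a) set \<Rightarrow> ('a \<Rightarrow> nat) set" where
  "linear_extensions A r =
     {f \<in> A \<rightarrow>\<^sub>E {1..card A}. bij_betw f A {1..card A} \<and>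
        monotone_on A (\<lambda>s t. (s, t) \<in> r) (\<le>) f}"

text \<open>
  The permutation \<open>\<pi>(f) = a\<^sub>1 \<dots> a\<^sub>n\<close> with \<open>a\<^sub>i = \<omega>(f\<^sup>-\<^sup>1(i))\<close>, extended by the identity
  outside \<open>{1..n}\<close>, which is how the library represents permutations of a subset of a type.
\<close>

definition ext_perm :: "'a set \<Rightarrow> ('a \<Rightarrow> nat) \<Rightarrow> ('a \<Rightarrow> nat) \<Rightarrow> nat \<Rightarrow> nat" where
  "ext_perm A \<omega> f i = (if i \<in> {1..card A} then \<omega> (inv_into A f i) else i)"

lemma ext_perm_permutes:
  assumes "labeling A \<omega>" and "f \<in> linear_extensions A r"
  shows "ext_perm A \<omega> f permutes {1..card A}"
proof (rule bij_imp_permutes)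
  have "bij_betw (inv_into A f) {1..card A} A"
    using assms(2) by (simp add: linear_extensions_def bij_betw_inv_into)
  then have "bij_betw (\<omega> \<circ> inv_into A f) {1..card A} {1..card A}"
    using assms(1) unfolding labeling_def by (rule bij_betw_trans)
  then show "bij_betw (ext_perm A \<omega> f) {1..card A} {1..card A}"
    by (rule bij_betw_cong[THEN iffD1, rotated]) (simp add: ext_perm_def)
qed (auto simp: ext_perm_def)

text \<open>
  Whether the two counts agree does not depend on the labeling, so any fixed labeling may be
  used; the definition asks for all of them, and is not vacuous by the lemma that follows.
\<close>

definition sign_balanced :: "'a set \<Rightarrow> ('a \<times> 'a) set \<Rightarrow> bool" where
  "sign_balanced A r \<longleftrightarrow>
     (\<forall>\<omega>. labeling A \<omega> \<longrightarrow>
        card {f \<in> linear_extensions A r. evenperm (ext_perm A \<omega> f)} =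
        card {f \<in> linear_extensions A r. \<not> evenperm (ext_perm A \<omega> f)})"

lemma labeling_exists: "finite A \<Longrightarrow> \<exists>\<omega>. labeling A \<omega>"
  unfolding labeling_def by (rule finite_same_card_bij) simp_all

definition order_ideal :: "'a set \<Rightarrow> ('a \<times> 'a) set \<Rightarrow> 'a set \<Rightarrow> bool" where
  "order_ideal A r K \<longleftrightarrow>
     K \<subseteq> A \<and> (\<forall>t\<in>K. \<forall>s\<in>A. (s, t) \<in> r \<and> s \<noteq> t \<longrightarrow> s \<in> K)"

definition ideal_chain :: "'a set \<Rightarrow> ('a \<times> 'a) set \<Rightarrow> nat \<Rightarrow> (nat \<Rightarrow> 'a set) \<Rightarrow> bool" where
  "ideal_chain A r k K \<longleftrightarrow>
     K 0 = {} \<and> K k = A \<and> (\<forall>i\<le>k. order_ideal A r (K i)) \<and>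
     (\<forall>i\<in>{1..k}. K (i - 1) \<subset> K i)"

definition two_element_chain :: "('a \<times> 'a) set \<Rightarrow> 'a set \<Rightarrow> bool" where
  "two_element_chain r C \<longleftrightarrow> card C = 2 \<and> C \<in> Chains r"

definition domino_tilable :: "'a set \<Rightarrow> ('a \<times> 'a) set \<Rightarrow> bool" where
  "domino_tilable A r \<longleftrightarrow>
     (\<exists>m K. card A = 2 * m \<and> ideal_chain A r m K \<and>
        (\<forall>i\<in>{1..m}. two_element_chain r (K i - K (i - 1))))"

definition j_domino_tilable :: "nat \<Rightarrow> 'a set \<Rightarrow> ('a \<times> 'a) set \<Rightarrow> bool" where
  "j_domino_tilable j A r \<longleftrightarrow>
     (\<exists>m K. card A = 2 * m + 1 \<and> 1 \<le> j \<and> j \<le> m + 1 \<and> ideal_chain A r (m + 1) K \<and>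
        (\<forall>i\<in>{1..m + 1}. i \<noteq> j \<longrightarrow> two_element_chain r (K i - K (i - 1))))"

end

theory Submission
  imports Defs
begin

text \<open>
  Fix pairwise disjoint pairs of consecutive positions \<open>{p, p + 1}\<close> in \<open>{1..n}\<close>. In a linear
  extension \<open>f\<close> call such a pair swappable if the elements at the two positions are
  incomparable. Exchanging these elements gives another linear extension, whose permutation
  differs from that of \<open>f\<close> by one transposition and hence has the opposite sign. Because the pairs
  are disjoint, the exchange does not affect which of them are swappable, so exchanging at the
  least swappable pair is a sign-reversing involution on the linear extensions that have one. If
  \<open>P\<close> is not sign-balanced, this involution cannot be defined everywhere: some \<open>f\<close> has no
  swappable pair (lemma \<open>ex_no_swappable\<close>).

  To read off a tiling from such an \<open>f\<close>, cut \<open>{1..n}\<close> into consecutive blocks, and take the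
  blocks of size two as the chosen pairs. The preimages under \<open>f\<close> of the initial segments are
  order ideals, and the preimage of a block of size two is a chain, since it consists of two
  comparable elements (lemma \<open>ex_ideal_chain_of_cuts\<close>). For \<open>n = 2m\<close> all blocks have size two;
  for \<open>n = 2m + 1\<close> the \<open>j\<close>-th block has size one and the others size two.
\<close>

text \<open>
  One direction of comparability is enough here: a linear extension never places an element
  immediately before a smaller one.
\<close>

definition swappable :: "'a set \<Rightarrow> ('a \<times> 'a) set \<Rightarrow> ('a \<Rightarrow> nat) \<Rightarrow> nat \<Rightarrow> bool" where
  "swappable A r f p \<longleftrightarrow> (inv_into A f p, inv_into A f (Suc p)) \<notin> r"

definition swap_at :: "'a set \<Rightarrow> nat \<Rightarrow> ('a \<Rightarrow> nat) \<Rightarrow> 'a \<Rightarrow> nat" where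
  "swap_at A p f = (\<lambda>x\<in>A. transpose p (Suc p) (f x))"

lemma linear_extensionsD:
  assumes "f \<in> linear_extensions A r"
  shows "bij_betw f A {1..card A}"
    and "f \<in> extensional A"
    and "\<And>s t. s \<in> A \<Longrightarrow> t \<in> A \<Longrightarrow> (s, t) \<in> r \<Longrightarrow> f s \<le> f t"
  using assms by (auto simp: linear_extensions_def PiE_def monotone_on_def)

lemma transpose_adjacent_permutes:
  assumes "1 \<le> p" "p < n"
  shows "transpose p (Suc p) permutes {1..n}"
  using assms by (intro permutes_swap_id) auto

lemma swap_at_bij_betw:
  assumes "bij_betw f A {1..n}" "1 \<le> p" "p < n"
  shows "bij_betw (swap_at A p f) A {1..n}"
proof -
  have "bij_betw (transpose p (Suc p) \<circ> f) A {1..n}"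
    using assms(1) permutes_imp_bij[OF transpose_adjacent_permutes[OF assms(2,3)]]
    by (rule bij_betw_trans)
  then show ?thesis
    by (rule bij_betw_cong[THEN iffD1, rotated]) (simp add: swap_at_def)
qed

lemma swap_at_swap_at:
  assumes "f \<in> extensional A"
  shows "swap_at A p (swap_at A p f) = f"
  using assms by (auto simp: swap_at_def fun_eq_iff extensional_def)

lemma inv_into_swap_at:
  assumes f: "bij_betw f A {1..n}" and p: "1 \<le> p" "p < n" and i: "i \<in> {1..n}"
  shows "inv_into A (swap_at A p f) i = inv_into A f (transpose p (Suc p) i)"
proof (rule inv_into_f_eq)
  show "inj_on (swap_at A p f) A"
    using swap_at_bij_betw[OF f p] by (rule bij_betw_imp_inj_on)
  have ti: "transpose p (Suc p) i \<in> {1..n}"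
    using permutes_in_image[OF transpose_adjacent_permutes[OF p]] i by blast
  then show inA: "inv_into A f (transpose p (Suc p) i) \<in> A"
    using f by (metis bij_betw_imp_surj_on inv_into_into)
  have "f (inv_into A f (transpose p (Suc p) i)) = transpose p (Suc p) i"
    using f ti by (rule bij_betw_inv_into_right)
  then show "swap_at A p f (inv_into A f (transpose p (Suc p) i)) = i"
    using inA by (simp add: swap_at_def)
qed

lemma swap_at_linear_extensions:
  assumes f: "f \<in> linear_extensions A r" and p: "1 \<le> p" "p < card A"
    and sw: "swappable A r f p"
  shows "swap_at A p f \<in> linear_extensions A r"
proof -
  note bij = linear_extensionsD(1)[OF f]
  have mono: "swap_at A p f s \<le> swap_at A p f t"
    if st: "s \<in> A" "t \<in> A" "(s, t) \<in> r" for s t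
  proof -
    have le: "f s \<le> f t"
      using linear_extensionsD(3)[OF f] st by blast
    have "\<not> (f s = p \<and> f t = Suc p)"
      using sw st bij_betw_inv_into_left[OF bij st(1)] bij_betw_inv_into_left[OF bij st(2)]
      by (auto simp: swappable_def)
    \<comment> \<open>An adjacent transposition reverses the order of no other pair of positions.\<close>
    with le show ?thesis
      using st by (auto simp: swap_at_def transpose_def)
  qed
  have bij': "bij_betw (swap_at A p f) A {1..card A}"
    using bij p by (rule swap_at_bij_betw)
  moreover have "swap_at A p f \<in> A \<rightarrow>\<^sub>E {1..card A}"
    using bij_betw_imp_funcset[OF bij'] by (simp add: PiE_def swap_at_def)
  ultimately show ?thesis
    using mono by (auto simp: linear_extensions_def monotone_on_def)
qed

lemma evenperm_ext_perm_swap_at: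
  assumes \<omega>: "labeling A \<omega>" and f: "f \<in> linear_extensions A r"
    and p: "1 \<le> p" "p < card A"
  shows "evenperm (ext_perm A \<omega> (swap_at A p f)) \<longleftrightarrow> \<not> evenperm (ext_perm A \<omega> f)"
proof -
  note tp = transpose_adjacent_permutes[OF p]
  have "ext_perm A \<omega> (swap_at A p f) = ext_perm A \<omega> f \<circ> transpose p (Suc p)"
  proof
    fix i
    show "ext_perm A \<omega> (swap_at A p f) i = (ext_perm A \<omega> f \<circ> transpose p (Suc p)) i"
    proof (cases "i \<in> {1..card A}")
      case True
      then have "transpose p (Suc p) i \<in> {1..card A}"
        using permutes_in_image[OF tp] by blast
      with True show ?thesis
        using inv_into_swap_at[OF linear_extensionsD(1)[OF f] p True]
        by (simp add: ext_perm_def)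
    next
      case False
      then show ?thesis
        using permutes_not_in[OF tp False] by (simp only: ext_perm_def comp_apply if_False)
    qed
  qed
  moreover have "permutation (ext_perm A \<omega> f)" "permutation (transpose p (Suc p))"
    using ext_perm_permutes[OF \<omega> f] tp by (auto intro: permutes_imp_permutation[rotated])
  ultimately show ?thesis
    by (simp add: evenperm_comp evenperm_swap)
qed

text \<open>
  Exchanging at \<open>p\<close> does not touch the pair at any other \<open>q \<in> S\<close>, and leaves the
  incomparable pair at \<open>p\<close> incomparable.
\<close>

lemma swappable_swap_at:
  assumes f: "f \<in> linear_extensions A r"
    and S: "S \<subseteq> {1..<card A}" "\<And>q. q \<in> S \<Longrightarrow> Suc q \<notin> S"
    and p: "p \<in> S" "swappable A r f p" and q: "q \<in> S"
  shows "swappable A r (swap_at A p f) q \<longleftrightarrow> swappable A r f q"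
proof -
  note bij = linear_extensionsD(1)[OF f]
  have pn: "1 \<le> p" "p < card A" and qn: "q \<in> {1..card A}" "Suc q \<in> {1..card A}"
    using S(1) p(1) q by auto
  note inv = inv_into_swap_at[OF bij pn qn(1)] inv_into_swap_at[OF bij pn qn(2)]
  show ?thesis
  proof (cases "q = p")
    case True
    have range: "p \<in> {1..card A}" "Suc p \<in> {1..card A}"
      using pn by auto
    have "(inv_into A f (Suc p), inv_into A f p) \<notin> r"
    proof
      assume "(inv_into A f (Suc p), inv_into A f p) \<in> r"
      moreover have "inv_into A f p \<in> A" "inv_into A f (Suc p) \<in> A"
        using bij range by (metis bij_betw_imp_surj_on inv_into_into)+
      ultimately have "f (inv_into A f (Suc p)) \<le> f (inv_into A f p)"
        using linear_extensionsD(3)[OF f] by blast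
      then show False
        using bij_betw_inv_into_right[OF bij] range by simp
    qed
    then show ?thesis
      using True inv p(2) by (simp add: swappable_def)
  next
    case False
    then have "q \<noteq> Suc p" "Suc q \<noteq> p"
      using S(2) p(1) q by auto
    with False show ?thesis
      using inv by (simp add: swappable_def transpose_def)
  qed
qed

theorem ex_no_swappable:
  assumes unbal: "\<not> sign_balanced A r"
    and S: "S \<subseteq> {1..<card A}" "\<And>q. q \<in> S \<Longrightarrow> Suc q \<notin> S"
  shows "\<exists>f \<in> linear_extensions A r. \<forall>p\<in>S. \<not> swappable A r f p"
proof (rule ccontr)
  assume "\<not> ?thesis"
  then have ex: "\<exists>p. p \<in> S \<and> swappable A r f p" if "f \<in> linear_extensions A r" for f
    using that by blast
  define \<mu> where "\<mu> f = (LEAST p. p \<in> S \<and> swappable A r f p)" for f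
  define g where "g f = swap_at A (\<mu> f) f" for f
  have \<mu>: "\<mu> f \<in> S" "swappable A r f (\<mu> f)" if "f \<in> linear_extensions A r" for f
    using LeastI_ex[OF ex[OF that]] by (auto simp: \<mu>_def)
  have \<mu>n: "1 \<le> \<mu> f" "\<mu> f < card A" if "f \<in> linear_extensions A r" for f
    using \<mu>(1)[OF that] S(1) by auto
  have gL: "g f \<in> linear_extensions A r" if "f \<in> linear_extensions A r" for f
    unfolding g_def using that \<mu>n[OF that] \<mu>(2)[OF that] by (rule swap_at_linear_extensions)
  have \<mu>g: "\<mu> (g f) = \<mu> f" if "f \<in> linear_extensions A r" for f
  proof -
    have "q \<in> S \<and> swappable A r (g f) q \<longleftrightarrow> q \<in> S \<and> swappable A r f q" for q
      using swappable_swap_at[OF that S \<mu>[OF that]] by (auto simp: g_def)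
    then show ?thesis
      by (simp add: \<mu>_def)
  qed
  have gg: "g (g f) = f" if "f \<in> linear_extensions A r" for f
    using \<mu>g[OF that] swap_at_swap_at[OF linear_extensionsD(2)[OF that]]
    by (simp add: g_def)
  have "sign_balanced A r"
    unfolding sign_balanced_def
  proof (intro allI impI)
    fix \<omega> assume \<omega>: "labeling A \<omega>"
    let ?E = "{f \<in> linear_extensions A r. evenperm (ext_perm A \<omega> f)}"
    let ?O = "{f \<in> linear_extensions A r. \<not> evenperm (ext_perm A \<omega> f)}"
    have sign: "evenperm (ext_perm A \<omega> (g f)) \<longleftrightarrow> \<not> evenperm (ext_perm A \<omega> f)"
      if "f \<in> linear_extensions A r" for f
      unfolding g_def using \<omega> that \<mu>n[OF that] by (rule evenperm_ext_perm_swap_at)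
    have "bij_betw g ?E ?O"
      by (rule bij_betw_byWitness[where f' = g]) (auto simp: gg gL sign)
    then show "card ?E = card ?O"
      by (rule bij_betw_same_card)
  qed
  with unbal show False by blast
qed

text \<open>
  The sequence \<open>c\<close> lists the ends of the blocks into which \<open>{1..card A}\<close> is cut.
\<close>

theorem ex_ideal_chain_of_cuts:
  assumes po: "partial_order_on A r" and unbal: "\<not> sign_balanced A r"
    and c: "c 0 = 0" "c k = card A" "\<And>i. i \<in> {1..k} \<Longrightarrow> c (i - 1) < c i"
  shows "\<exists>K. ideal_chain A r k K \<and>
    (\<forall>i\<in>{1..k}. c i = c (i - 1) + 2 \<longrightarrow> two_element_chain r (K i - K (i - 1)))"
proof -
  have c_mono: "c i \<le> c j" if "i \<le> j" "j \<le> k" for i j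
    using that
  proof (induction j rule: dec_induct)
    case (step j)
    with c(3)[of "Suc j"] show ?case by simp
  qed simp
  define S where "S = {Suc (c (i - 1)) |i. i \<in> {1..k} \<and> c i = c (i - 1) + 2}"
  have S_range: "S \<subseteq> {1..<card A}"
  proof
    fix p assume "p \<in> S"
    then obtain i where i: "i \<in> {1..k}" "c i = c (i - 1) + 2" "p = Suc (c (i - 1))"
      by (auto simp: S_def)
    moreover have "c i \<le> card A"
      using c_mono[of i k] i(1) c(2) by simp
    ultimately show "p \<in> {1..<card A}" by simp
  qed
  have S_spaced: "Suc p \<notin> S" if "p \<in> S" for p
  proof
    assume "Suc p \<in> S"
    then obtain i' where i': "i' \<in> {1..k}" "Suc p = Suc (c (i' - 1))"
      by (auto simp: S_def)
    from \<open>p \<in> S\<close> obtain i where i: "i \<in> {1..k}" "c i = c (i - 1) + 2" "p = Suc (c (i - 1))"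
      by (auto simp: S_def)
    \<comment> \<open>The cut \<open>c (i' - 1)\<close> would lie strictly between the consecutive cuts \<open>c (i - 1)\<close> and \<open>c i\<close>.\<close>
    have "c (i' - 1) = Suc (c (i - 1))"
      using i i' by simp
    moreover have "c (i' - 1) \<le> c (i - 1) \<or> c i \<le> c (i' - 1)"
    proof (cases "i' \<le> i")
      case True
      then show ?thesis using c_mono[of "i' - 1" "i - 1"] i(1) by auto
    next
      case False
      then show ?thesis using c_mono[of i "i' - 1"] i'(1) by auto
    qed
    ultimately show False using i(2) by simp
  qed
  obtain f where f: "f \<in> linear_extensions A r" and comp: "\<And>p. p \<in> S \<Longrightarrow> \<not> swappable A r f p"
    using ex_no_swappable[OF unbal S_range S_spaced] by blast
  note bij = linear_extensionsD(1)[OF f]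
  define K where "K i = {x \<in> A. f x \<le> c i}" for i
  have f_range: "f x \<in> {1..card A}" if "x \<in> A" for x
    using bij that by (rule bij_betw_apply)
  have inv_A: "inv_into A f p \<in> A" and f_inv: "f (inv_into A f p) = p" if "p \<in> {1..card A}" for p
    using bij that by (metis bij_betw_imp_surj_on inv_into_into, rule bij_betw_inv_into_right)
  have "ideal_chain A r k K"
    unfolding ideal_chain_def
  proof (intro conjI ballI allI impI)
    show "K 0 = {}" "K k = A"
      using f_range c(1,2) by (fastforce simp: K_def)+
    show "order_ideal A r (K i)" for i
      using linear_extensionsD(3)[OF f] by (fastforce simp: order_ideal_def K_def)
    show "K (i - 1) \<subset> K i" if i: "i \<in> {1..k}" for i
    proof -
      have lt: "c (i - 1) < c i" and le: "c i \<le> card A"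
        using c(3)[OF i] c_mono[of i k] i c(2) by auto
      then have "c i \<in> {1..card A}" by simp
      then have "inv_into A f (c i) \<in> K i - K (i - 1)"
        using inv_A f_inv lt by (simp add: K_def)
      moreover have "K (i - 1) \<subseteq> K i"
        using lt by (auto simp: K_def)
      ultimately show ?thesis by blast
    qed
  qed
  moreover have "two_element_chain r (K i - K (i - 1))"
    if i: "i \<in> {1..k}" "c i = c (i - 1) + 2" for i
  proof -
    let ?p = "Suc (c (i - 1))"
    let ?s = "inv_into A f ?p" and ?t = "inv_into A f (Suc ?p)"
    have "?p \<in> S"
      using i by (auto simp: S_def)
    with S_range have p: "?p \<in> {1..card A}" "Suc ?p \<in> {1..card A}"
      by auto
    have st: "?s \<in> A" "?t \<in> A" "f ?s = ?p" "f ?t = Suc ?p"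
      using inv_A[OF p(1)] inv_A[OF p(2)] f_inv[OF p(1)] f_inv[OF p(2)] by blast+
    have "K i - K (i - 1) = {?s, ?t}"
    proof
      show "{?s, ?t} \<subseteq> K i - K (i - 1)"
        using st i(2) by (simp add: K_def)
      show "K i - K (i - 1) \<subseteq> {?s, ?t}"
      proof
        fix x assume x: "x \<in> K i - K (i - 1)"
        then have "x \<in> A" "f x = ?p \<or> f x = Suc ?p"
          using i(2) by (auto simp: K_def)
        then show "x \<in> {?s, ?t}"
          using bij_betw_inv_into_left[OF bij \<open>x \<in> A\<close>] by auto
      qed
    qed
    moreover have "?s \<noteq> ?t"
      using st by (metis n_not_Suc_n)
    moreover have "(?s, ?t) \<in> r"
      using comp[OF \<open>?p \<in> S\<close>] by (simp add: swappable_def)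
    moreover have "(?s, ?s) \<in> r" "(?t, ?t) \<in> r"
      using po st by (auto simp: partial_order_on_def preorder_on_def refl_on_def)
    ultimately show ?thesis
      by (auto simp: two_element_chain_def Chains_def)
  qed
  ultimately show ?thesis by blast
qed

theorem corollary4p2:
  fixes A :: "'a set" and r :: "('a \<times> 'a) set" and m :: nat
  assumes "finite A" and "partial_order_on A r"
  shows "(card A = 2 * m \<and> \<not> domino_tilable A r \<longrightarrow> sign_balanced A r) \<and>
    (card A = 2 * m + 1 \<and> 2 * m + 1 \<ge> 3 \<and>
      (\<exists>j. 1 \<le> j \<and> j \<le> m + 1 \<and> \<not> j_domino_tilable j A r) \<longrightarrow> sign_balanced A r)"
proof (intro conjI impI; rule ccontr)
  assume even: "card A = 2 * m \<and> \<not> domino_tilable A r" and unbal: "\<not> sign_balanced A r"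
  have "\<exists>K. ideal_chain A r m K \<and>
      (\<forall>i\<in>{1..m}. 2 * i = 2 * (i - 1) + 2 \<longrightarrow> two_element_chain r (K i - K (i - 1)))"
    by (rule ex_ideal_chain_of_cuts[OF assms(2) unbal]) (use even in auto)
  then obtain K where K: "ideal_chain A r m K"
      and blocks: "\<And>i. i \<in> {1..m} \<Longrightarrow> 2 * i = 2 * (i - 1) + 2 \<Longrightarrow>
        two_element_chain r (K i - K (i - 1))"
    by blast
  have "two_element_chain r (K i - K (i - 1))" if "i \<in> {1..m}" for i
    using that by (intro blocks) auto
  with K even show False
    unfolding domino_tilable_def by blast
next
  assume odd: "card A = 2 * m + 1 \<and> 2 * m + 1 \<ge> 3 \<and>
      (\<exists>j. 1 \<le> j \<and> j \<le> m + 1 \<and> \<not> j_domino_tilable j A r)"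
    and unbal: "\<not> sign_balanced A r"
  then obtain j where j: "1 \<le> j" "j \<le> m + 1" and not_tilable: "\<not> j_domino_tilable j A r"
    by blast
  \<comment> \<open>Only the step from \<open>j - 1\<close> to \<open>j\<close> has length one.\<close>
  define c :: "nat \<Rightarrow> nat" where "c i = (if i < j then 2 * i else 2 * i - 1)" for i
  have "\<exists>K. ideal_chain A r (m + 1) K \<and>
      (\<forall>i\<in>{1..m + 1}. c i = c (i - 1) + 2 \<longrightarrow> two_element_chain r (K i - K (i - 1)))"
    by (rule ex_ideal_chain_of_cuts[OF assms(2) unbal]) (use odd j in \<open>auto simp: c_def\<close>)
  then obtain K where K: "ideal_chain A r (m + 1) K"
      and blocks: "\<And>i. i \<in> {1..m + 1} \<Longrightarrow> c i = c (i - 1) + 2 \<Longrightarrow>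
        two_element_chain r (K i - K (i - 1))"
    by blast
  have "two_element_chain r (K i - K (i - 1))" if "i \<in> {1..m + 1}" "i \<noteq> j" for i
    using that j by (intro blocks) (auto simp: c_def)
  with K odd j have "j_domino_tilable j A r"
    unfolding j_domino_tilable_def by blast
  with not_tilable show False ..
qed

end
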